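(* Consider the P-SSD algorithm described in the context, executed over a time-varying digraph $\{G_k=(\{1,\dots,M\},E_k)\}_{k=1}^\infty$ that is repeatedly jointly strongly connected, and let $C_{\mathrm{SSD}}=\mathrm{SSD}(D(X),D(Y))$. Then there exists $l\in\mathbb{N}$ such that for every iteration $k\ge l$, $C_k^i=C_l^i$ for all $i\in\{1,\dots,M\}$, and $$\mathcal{R}(C_l^1)=\mathcal{R}(C_l^2)=\cdots=\mathcal{R}(C_l^M)=\mathcal{R}(C_{\mathrm{SSD}}).$$
   Context: Data setting: a map $T:\mathcal{M}\to\mathcal{M}$, $\mathcal{M}\subseteq\mathbb{R}^n$; a dictionary $D(x)=[d_1(x),\dots,d_{N_d}(x)]$ of real-valued functions on $\mathcal{M}$; data matrices $X,Y\in\mathbb{R}^{N\times n}$ whose $i$-th rows $x_i^T,y_i^T$ satisfy $y_i=T(x_i)$; $D(X)\in\mathbb{R}^{N\times N_d}$ is the matrix with rows $D(x_1),\dots,D(x_N)$ (similarly $D(Y)$). Assumption: $D(X)$ and $D(Y)$ have full column rank. There are $M$ agents; agent $i$ holds local dictionary snapshots $D(X_i),D(Y_i)$ (obtained from a subset of the snapshot pairs) such that the union over $i$ of the rows of $[D(X_i),D(Y_i)]$ equals the set of rows of $[D(X),D(Y)]$. There are signature matrices $D(X_s),D(Y_s)$ with full column rank such that the rows of $[D(X_s),D(Y_s)]$ are contained in the rows of $[D(X_i),D(Y_i)]$ for every $i$. SSD algorithm: given $A,B\in\mathbb{R}^{m\times q}$, set $A_1=A$, $B_1=B$, $C=I_q$,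 and iterate: let $[Z^A_j;Z^B_j]$ be a matrix whose columns form a basis of the null space of $[A_j,B_j]$ (with $Z^A_j$ having as many rows as $A_j$ has columns); if the null space is trivial return $0$; if the number of rows of $Z^A_j$ is at most its number of columns, return $C$; otherwise set $C\leftarrow CZ^A_j$, $A_{j+1}=A_jZ^A_j$, $B_{j+1}=B_jZ^A_j$. Its output is denoted $\mathrm{SSD}(A,B)$. P-SSD algorithm: at iteration $k\ge1$ the digraph $G_k$ is used; an edge $(j,i)\in E_k$ means $j$ is an in-neighbor of $i$, and $\mathcal{N}_{\mathrm{in}}^k(i)$ denotes the in-neighbors of $i$ in $G_k$. Each agent $i$ sets $C_0^i=I_{N_d}$, $\mathrm{flag}_0^i=0$, and for $k=1,2,\dots$: receives $C_{k-1}^j$ for $j\in\mathcal{N}_{\mathrm{in}}^k(i)$; sets $D_k^i=\mathrm{basis}\big(\bigcap_{j\in\{i\}\cup\mathcal{N}_{\mathrm{in}}^k(i)}\mathcal{R}(C_{k-1}^j)\big)$; sets $E_k^i=\mathrm{SSD}(D(X_i)D_k^i,D(Y_i)D_k^i)$; if the number of columns of $D_k^iE_k^i$ is strictly less than that of $C_{k-1}^i$, sets $C_k^i=D_k^iE_k^i$ and $\mathrm{flag}_k^i=0$; otherwise sets $C_k^i=C_{k-1}^i$ and $\mathrm{flag}_k^i=1$; then transmits $C_k^i$ to its out-neighbors. Here $\mathrm{basis}(\mathcal{A})$ returns a matrix whose columns form a basis of the subspace $\mathcal{A}$, and returns $0$ if $\mathcal{A}=\{0\}$; the matrix $0$ is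 regarded as having $0$ columns. $\mathcal{R}(\cdot)$ denotes range space. Graph notions: the composition of digraphs $G_1=(V,E_1)$, $G_2=(V,E_2)$ is $G_2\circ G_1=(V,E_\circ)$ with $E_\circ=\{(i,j):\exists k\in V,\ (i,k)\in E_1,\ (k,j)\in E_2\}$. A finite sequence $G_1,\dots,G_k$ is jointly strongly connected if $G_k\circ\cdots\circ G_1$ is strongly connected (a directed path exists from every node to every other node). A sequence $\{G_i\}_{i=1}^\infty$ is repeatedly jointly strongly connected if there exist $l,\tau\in\mathbb{N}$ such that for every $k\in\mathbb{N}_0$ the sequence $\{G_{\tau+kl+j}\}_{j=0}^{l-1}$ is jointly strongly connected. *)

theory Defs
  imports "Jordan_Normal_Form.Matrix"
begin

definition col_range :: "real mat \<Rightarrow> real vec set" where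
  "col_range C = {C *\<^sub>v x | x. x \<in> carrier_vec (dim_col C)}"

definition full_col_rank :: "real mat \<Rightarrow> bool" where
  "full_col_rank A \<longleftrightarrow>
     (\<forall>x \<in> carrier_vec (dim_col A). A *\<^sub>v x = 0\<^sub>v (dim_row A) \<longrightarrow> x = 0\<^sub>v (dim_col A))"

text \<open>The columns of B (an n-row matrix) form a basis of the subspace S of R^n.
  For S = {0} this forces B to have 0 columns, i.e. B is the matrix 0 with 0 columns.\<close>
definition is_basis_mat :: "nat \<Rightarrow> real vec set \<Rightarrow> real mat \<Rightarrow> bool" where
  "is_basis_mat n S B \<longleftrightarrow> dim_row B = n \<and> full_col_rank B \<and> col_range B = S"

text \<open>The columns of the stacked matrix [ZA; ZB] form a basis of the null space of [A, B]
  (A, B of equal size, ZA and ZB having as many rows as A has columns).\<close>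
definition null_basis :: "real mat \<Rightarrow> real mat \<Rightarrow> real mat \<Rightarrow> real mat \<Rightarrow> bool" where
  "null_basis A B ZA ZB \<longleftrightarrow>
     dim_row B = dim_row A \<and> dim_col B = dim_col A \<and>
     dim_row ZA = dim_col A \<and> dim_row ZB = dim_col A \<and> dim_col ZB = dim_col ZA \<and>
     (\<forall>x \<in> carrier_vec (dim_col ZA). A *\<^sub>v (ZA *\<^sub>v x) + B *\<^sub>v (ZB *\<^sub>v x) = 0\<^sub>v (dim_row A)) \<and>
     (\<forall>x \<in> carrier_vec (dim_col ZA).
        ZA *\<^sub>v x = 0\<^sub>v (dim_col A) \<and> ZB *\<^sub>v x = 0\<^sub>v (dim_col A) \<longrightarrow> x = 0\<^sub>v (dim_col ZA)) \<and>
     (\<forall>u \<in> carrier_vec (dim_col A). \<forall>w \<in> carrier_vec (dim_col A).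
        A *\<^sub>v u + B *\<^sub>v w = 0\<^sub>v (dim_row A) \<longrightarrow>
        (\<exists>x \<in> carrier_vec (dim_col ZA). ZA *\<^sub>v x = u \<and> ZB *\<^sub>v x = w))"

section \<open>The SSD algorithm (all possible outputs, over all choices of null-space bases)\<close>

text \<open>ssd_iter A B C out: starting the loop with current matrices A = A_j, B = B_j and
  accumulated C, the algorithm can return out.\<close>
inductive ssd_iter :: "real mat \<Rightarrow> real mat \<Rightarrow> real mat \<Rightarrow> real mat \<Rightarrow> bool" where
  trivial: "null_basis A B ZA ZB \<Longrightarrow> dim_col ZA = 0 \<Longrightarrow>
            ssd_iter A B C (0\<^sub>m (dim_row C) 0)"
| stop: "null_basis A B ZA ZB \<Longrightarrow> dim_col ZA \<noteq> 0 \<Longrightarrow> dim_row ZA \<le> dim_col ZA \<Longrightarrow>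
         ssd_iter A B C C"
| step: "null_basis A B ZA ZB \<Longrightarrow> dim_col ZA \<noteq> 0 \<Longrightarrow> dim_row ZA > dim_col ZA \<Longrightarrow>
         ssd_iter (A * ZA) (B * ZA) (C * ZA) out \<Longrightarrow> ssd_iter A B C out"

definition ssd :: "real mat \<Rightarrow> real mat \<Rightarrow> real mat \<Rightarrow> bool" where
  "ssd A B E \<longleftrightarrow> ssd_iter A B (1\<^sub>m (dim_col A)) E"

definition in_nbrs :: "nat \<Rightarrow> (nat \<times> nat) set \<Rightarrow> nat \<Rightarrow> nat set" where
  "in_nbrs M E i = {j \<in> {1..M}. (j, i) \<in> E}"

text \<open>Composition G2 o G1 (the first argument E1 is the edge set of G1).\<close>
definition dg_comp :: "(nat \<times> nat) set \<Rightarrow> (nat \<times> nat) set \<Rightarrow> (nat \<times> nat) set" where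
  "dg_comp E1 E2 = {(i, j). \<exists>k. (i, k) \<in> E1 \<and> (k, j) \<in> E2}"

fun comp_seq :: "nat \<Rightarrow> (nat \<Rightarrow> (nat \<times> nat) set) \<Rightarrow> nat \<Rightarrow> nat \<Rightarrow> (nat \<times> nat) set" where
  "comp_seq M G a 0 = Id_on {1..M}"
| "comp_seq M G a (Suc n) = dg_comp (comp_seq M G a n) (G (a + n))"

definition strongly_connected :: "nat \<Rightarrow> (nat \<times> nat) set \<Rightarrow> bool" where
  "strongly_connected M E \<longleftrightarrow> (\<forall>i \<in> {1..M}. \<forall>j \<in> {1..M}. i \<noteq> j \<longrightarrow> (i, j) \<in> E\<^sup>+)"

definition jointly_strongly_connected :: "nat \<Rightarrow> (nat \<Rightarrow> (nat \<times> nat) set) \<Rightarrow> nat \<Rightarrow> nat \<Rightarrow> bool" where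
  "jointly_strongly_connected M G a n \<longleftrightarrow> strongly_connected M (comp_seq M G a n)"

definition rep_jointly_strongly_connected :: "nat \<Rightarrow> (nat \<Rightarrow> (nat \<times> nat) set) \<Rightarrow> bool" where
  "rep_jointly_strongly_connected M G \<longleftrightarrow>
     (\<exists>l \<tau>. l \<ge> 1 \<and> \<tau> \<ge> 1 \<and> (\<forall>k. jointly_strongly_connected M G (\<tau> + k * l) l))"

text \<open>C k i is the matrix C_k^i of agent i after iteration k. The flags do not influence
  the matrices and are omitted.\<close>
definition pssd_run :: "nat \<Rightarrow> nat \<Rightarrow> (nat \<Rightarrow> (nat \<times> nat) set) \<Rightarrow>
     (nat \<Rightarrow> real mat) \<Rightarrow> (nat \<Rightarrow> real mat) \<Rightarrow> (nat \<Rightarrow> nat \<Rightarrow> real mat) \<Rightarrow> bool" where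
  "pssd_run M Nd G DXi DYi C \<longleftrightarrow>
     (\<forall>i \<in> {1..M}. C 0 i = 1\<^sub>m Nd) \<and>
     (\<forall>k \<ge> 1. \<forall>i \<in> {1..M}. \<exists>D E.
        is_basis_mat Nd (\<Inter>j \<in> insert i (in_nbrs M (G k) i). col_range (C (k - 1) j)) D \<and>
        ssd (DXi i * D) (DYi i * D) E \<and>
        C k i = (if dim_col (D * E) < dim_col (C (k - 1) i) then D * E else C (k - 1) i))"

end

theory Submission
  imports Defs "Jordan_Normal_Form.Determinant"
begin

text \<open>Whatever null-space bases are chosen, \<open>SSD(A, B)\<close> has as its range the greatest set \<open>S\<close> with
  \<open>A S \<subseteq> B S\<close>. Hence \<open>R(C\<^sub>k\<^sup>i)\<close> is the greatest such \<open>S\<close>, for the data of agent \<open>i\<close>, inside the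
  intersection of the ranges it receives, and \<open>R(C\<^sub>S\<^sub>S\<^sub>D)\<close> is never cut away. The numbers of columns
  decrease, so all matrices are eventually constant; from then on an edge \<open>(j, i)\<close> forces
  \<open>R(C\<^sup>i) \<subseteq> R(C\<^sup>j)\<close>, and joint strong connectivity makes all ranges equal to one space \<open>R\<close>. For
  \<open>u \<in> R\<close> every agent finds \<open>w \<in> R\<close> matching its own rows of \<open>D(X) u = D(Y) w\<close>; injectivity of
  \<open>D(Y\<^sub>s)\<close> makes \<open>w\<close> independent of the agent, so \<open>D(X) R \<subseteq> D(Y) R\<close> and \<open>R \<subseteq> R(C\<^sub>S\<^sub>S\<^sub>D)\<close>.\<close>

section \<open>Linear algebra: ranges and full column rank\<close>

lemma mult_mat_zero_vec:
  fixes A :: "real mat"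
  shows "A \<in> carrier_mat m q \<Longrightarrow> A *\<^sub>v 0\<^sub>v q = 0\<^sub>v m"
  by (intro eq_vecI) auto

lemma col_rangeI: "x \<in> carrier_vec (dim_col C) \<Longrightarrow> C *\<^sub>v x \<in> col_range C"
  by (auto simp: col_range_def)

lemma col_range_carrier: "C \<in> carrier_mat n q \<Longrightarrow> col_range C \<subseteq> carrier_vec n"
  by (auto simp: col_range_def)

lemma full_col_rankD:
  assumes "full_col_rank A" "A \<in> carrier_mat m q" "x \<in> carrier_vec q" "A *\<^sub>v x = 0\<^sub>v m"
  shows "x = 0\<^sub>v q"
  using assms by (auto simp: full_col_rank_def)

lemma full_col_rank_inj:
  assumes A: "full_col_rank A" "A \<in> carrier_mat m q" and x: "x \<in> carrier_vec q"
    and y: "y \<in> carrier_vec q" and "A *\<^sub>v x = A *\<^sub>v y"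
  shows "x = y"
proof -
  have "A *\<^sub>v (x - y) = A *\<^sub>v y - A *\<^sub>v y"
    using mult_minus_distrib_mat_vec[OF A(2) x y] assms(5) by simp
  also have "\<dots> = 0\<^sub>v m"
    using A(2) y by (intro minus_cancel_vec) simp
  finally have diff: "x - y = 0\<^sub>v q"
    using full_col_rankD[OF A, of "x - y"] x y by simp
  show "x = y"
  proof (rule eq_vecI)
    fix i assume "i < dim_vec y"
    then have i: "i < q" using y by simp
    have "(x - y) $ i = 0\<^sub>v q $ i" by (simp only: diff)
    then show "x $ i = y $ i" using x y i by simp
  qed (use x y in simp)
qed

lemma full_col_rank_mult:
  assumes rank: "full_col_rank A" "full_col_rank B"
    and A: "A \<in> carrier_mat m q" and B: "B \<in> carrier_mat q p"
  shows "full_col_rank (A * B)"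
  unfolding full_col_rank_def
proof (intro ballI impI)
  fix x assume "x \<in> carrier_vec (dim_col (A * B))" "A * B *\<^sub>v x = 0\<^sub>v (dim_row (A * B))"
  then have x: "x \<in> carrier_vec p" and 0: "A *\<^sub>v (B *\<^sub>v x) = 0\<^sub>v m"
    using A B by simp_all
  have "B *\<^sub>v x = 0\<^sub>v q"
    using B x by (intro full_col_rankD[OF rank(1) A _ 0]) simp
  then show "x = 0\<^sub>v (dim_col (A * B))"
    using full_col_rankD[OF rank(2) B x] B by simp
qed

lemma full_col_rank_one: "full_col_rank (1\<^sub>m n)"
  by (auto simp: full_col_rank_def)

lemma full_col_rank_zero_cols: "full_col_rank (0\<^sub>m n 0)"
  by (auto simp: full_col_rank_def)

lemma col_range_mult:
  assumes "A \<in> carrier_mat m q" "B \<in> carrier_mat q p"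
  shows "col_range (A * B) = (\<lambda>v. A *\<^sub>v v) ` col_range B"
proof -
  have "col_range (A * B) = (\<lambda>x. A * B *\<^sub>v x) ` carrier_vec p"
    using assms(2) by (auto simp: col_range_def)
  also have "\<dots> = (\<lambda>x. A *\<^sub>v (B *\<^sub>v x)) ` carrier_vec p"
    using assms by (intro image_cong) simp_all
  also have "\<dots> = (\<lambda>v. A *\<^sub>v v) ` col_range B"
    using assms(2) by (auto simp: col_range_def)
  finally show ?thesis .
qed

lemma col_range_one: "col_range (1\<^sub>m n) = carrier_vec n"
proof -
  have "col_range (1\<^sub>m n) = (\<lambda>x. 1\<^sub>m n *\<^sub>v x) ` carrier_vec n"
    by (simp only: col_range_def Setcompr_eq_image index_one_mat)
  also have "\<dots> = (\<lambda>x. x) ` carrier_vec n"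
    by (intro image_cong) simp_all
  finally show ?thesis by simp
qed

text \<open>An injective linear map into a space of no larger dimension is onto. This serves the
  stopping test of SSD and the comparison of column counts in P-SSD.\<close>

lemma full_col_rank_surj:
  assumes "full_col_rank Z" and Z: "Z \<in> carrier_mat m n" and "m \<le> n"
  shows "col_range Z = carrier_vec m"
proof
  show "col_range Z \<subseteq> carrier_vec m" using Z by (rule col_range_carrier)
  show "carrier_vec m \<subseteq> col_range Z"
  proof
    fix y :: "real vec" assume y: "y \<in> carrier_vec m"
    \<comment> \<open>Zero rows make \<open>Z\<close> square, so that its injectivity shows up in the determinant.\<close>
    define Z' where "Z' = mat n n (\<lambda>(i, j). if i < m then Z $$ (i, j) else 0)"
    have Z': "Z' \<in> carrier_mat n n" by (simp add: Z'_def)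
    have row: "row Z' i = row Z i" if "i < m" for i
      using that Z \<open>m \<le> n\<close> by (intro eq_vecI) (auto simp: Z'_def)
    have top: "(Z' *\<^sub>v x) $ i = (Z *\<^sub>v x) $ i" if "i < m" for i x
      using that Z Z' \<open>m \<le> n\<close> by (auto simp: row)
    have "det Z' \<noteq> 0"
    proof
      assume "det Z' = 0"
      then obtain x where x: "x \<in> carrier_vec n" "x \<noteq> 0\<^sub>v n" "Z' *\<^sub>v x = 0\<^sub>v n"
        using det_0_iff_vec_prod_zero[OF Z'] by auto
      have "Z *\<^sub>v x = 0\<^sub>v m"
        using x(3) Z \<open>m \<le> n\<close> by (intro eq_vecI) (simp_all add: top[symmetric] del: index_mult_mat_vec)
      then show False using full_col_rankD[OF assms(1) Z x(1)] x(2) by simp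
    qed
    then have "Z' \<in> Units (ring_mat TYPE(real) n ())"
      using det_non_zero_imp_unit[OF Z'] by simp
    then obtain W where W: "W \<in> carrier_mat n n" "Z' * W = 1\<^sub>m n"
      by (auto simp: Units_def ring_mat_def)
    define y' where "y' = vec n (\<lambda>i. if i < m then y $ i else 0)"
    have y': "y' \<in> carrier_vec n" by (simp add: y'_def)
    have "Z' *\<^sub>v (W *\<^sub>v y') = y'"
      using W Z' y' by (simp flip: assoc_mult_mat_vec)
    then have "Z *\<^sub>v (W *\<^sub>v y') = y"
      using Z y \<open>m \<le> n\<close>
      by (intro eq_vecI) (simp_all add: top[symmetric] y'_def del: index_mult_mat_vec)
    then show "y \<in> col_range Z"
      using col_rangeI[of "W *\<^sub>v y'" Z] W y' Z by auto
  qed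
qed

text \<open>Every column of \<open>P\<close> is a combination of columns of \<open>Q\<close>, so
  \<open>P = Q * Z\<close>. Injectivity passes from \<open>P\<close> to \<open>Z\<close>, and
  \<open>Z\<close> has at least as many columns as rows, hence is onto. This lets an agent that
  keeps its old matrix be treated like one that updates it.\<close>

lemma col_range_eq_of_dim:
  assumes "full_col_rank P" and sub: "col_range P \<subseteq> col_range Q"
    and "dim_row P = dim_row Q" and dim: "dim_col Q \<le> dim_col P"
  shows "col_range P = col_range Q"
proof -
  define n p q where "n = dim_row Q" and "p = dim_col P" and "q = dim_col Q"
  have P: "P \<in> carrier_mat n p" and Q: "Q \<in> carrier_mat n q" and "q \<le> p"
    using assms(3) dim by (auto simp: n_def p_def q_def)
  have "\<exists>z \<in> carrier_vec q. Q *\<^sub>v z = col P j" if "j < p" for j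
  proof -
    have "P *\<^sub>v unit_vec p j = col P j"
      using P that by (intro eq_vecI) auto
    then have "col P j \<in> col_range P"
      using P by (metis col_rangeI carrier_matD(2) unit_vec_carrier)
    then have "col P j \<in> col_range Q" using sub by blast
    then show ?thesis using Q by (auto simp: col_range_def)
  qed
  then obtain z where z: "\<And>j. j < p \<Longrightarrow> z j \<in> carrier_vec q \<and> Q *\<^sub>v z j = col P j"
    by metis
  define Z where "Z = mat_of_cols q (map z [0..<p])"
  have Z: "Z \<in> carrier_mat q p" by (auto simp: Z_def)
  have colZ: "col Z j = z j" if "j < p" for j
    unfolding Z_def using that z by (subst col_mat_of_cols) auto
  have PQZ: "P = Q * Z"
  proof (rule mat_col_eqI)
    fix j assume "j < dim_col (Q * Z)"
    then have "j < p" using Z by simp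
    then show "col P j = col (Q * Z) j"
      using col_mult2[OF Q Z] colZ z by simp
  qed (use P Q Z in auto)
  have "full_col_rank Z"
    unfolding full_col_rank_def
  proof (intro ballI impI)
    fix x assume "x \<in> carrier_vec (dim_col Z)" "Z *\<^sub>v x = 0\<^sub>v (dim_row Z)"
    then have x: "x \<in> carrier_vec p" "Z *\<^sub>v x = 0\<^sub>v q" using Z by auto
    then have "P *\<^sub>v x = 0\<^sub>v n" using Q Z by (simp add: PQZ mult_mat_zero_vec)
    then show "x = 0\<^sub>v (dim_col Z)" using full_col_rankD[OF assms(1) P] x Z by auto
  qed
  then have "col_range Z = carrier_vec q"
    using full_col_rank_surj Z \<open>q \<le> p\<close> by blast
  then have "col_range (Q * Z) = (\<lambda>v. Q *\<^sub>v v) ` carrier_vec q"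
    using col_range_mult[OF Q Z] by simp
  also have "\<dots> = col_range Q"
    using Q by (auto simp: col_range_def)
  finally show ?thesis by (simp only: PQZ)
qed

section \<open>The range of the SSD output as a greatest invariant set\<close>

text \<open>Here \<open>S\<close> is any set of vectors: the greatest such set is exhibited as the
  range of a matrix, so closure under linear operations is never carried along.\<close>

definition maps_into :: "real mat \<Rightarrow> real mat \<Rightarrow> real vec set \<Rightarrow> bool" where
  "maps_into A B S \<longleftrightarrow> (\<forall>u \<in> S. \<exists>w \<in> S. A *\<^sub>v u = B *\<^sub>v w)"

lemma maps_into_image_iff:
  assumes "A \<in> carrier_mat m n" "B \<in> carrier_mat m n" "D \<in> carrier_mat n q" "T \<subseteq> carrier_vec q"
  shows "maps_into A B ((\<lambda>v. D *\<^sub>v v) ` T) \<longleftrightarrow> maps_into (A * D) (B * D) T"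
proof -
  have "A * D *\<^sub>v x = A *\<^sub>v (D *\<^sub>v x)" "B * D *\<^sub>v x = B *\<^sub>v (D *\<^sub>v x)" if "x \<in> T" for x
    using assms that by (auto intro!: assoc_mult_mat_vec)
  then show ?thesis by (simp add: maps_into_def)
qed

text \<open>A set inside the range of \<open>D\<close> is the image under \<open>D\<close> of its
  preimage \<open>T\<close>, and invariance of the two is equivalent. Used for one refinement by
  \<open>ZA\<close> inside SSD and for the restriction of an agent's data to its basis
  \<open>D\<close>.\<close>

lemma maps_into_greatest_mult:
  assumes A: "A \<in> carrier_mat m n" and B: "B \<in> carrier_mat m n"
    and D: "D \<in> carrier_mat n q" and F: "F \<in> carrier_mat q r"
    and into: "maps_into (A * D) (B * D) (col_range F)"
    and max: "\<forall>T \<subseteq> carrier_vec q. maps_into (A * D) (B * D) T \<longrightarrow> T \<subseteq> col_range F"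
  shows "maps_into A B (col_range (D * F))"
    and "\<And>S. S \<subseteq> col_range D \<Longrightarrow> maps_into A B S \<Longrightarrow> S \<subseteq> col_range (D * F)"
proof -
  note iff = maps_into_image_iff[OF A B D]
  have R: "col_range (D * F) = (\<lambda>v. D *\<^sub>v v) ` col_range F"
    using D F by (rule col_range_mult)
  show "maps_into A B (col_range (D * F))"
    unfolding R using iff[OF col_range_carrier[OF F]] into by blast
  fix S assume S: "S \<subseteq> col_range D" "maps_into A B S"
  define T where "T = {x \<in> carrier_vec q. D *\<^sub>v x \<in> S}"
  have T: "T \<subseteq> carrier_vec q" by (auto simp: T_def)
  have DT: "S = (\<lambda>v. D *\<^sub>v v) ` T"
    using S(1) D by (auto simp: T_def col_range_def)
  have "maps_into (A * D) (B * D) T"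
    using S(2) iff[OF T] by (simp only: DT)
  then have "T \<subseteq> col_range F" using T max by blast
  then show "S \<subseteq> col_range (D * F)" unfolding R DT by (rule image_mono)
qed

lemma vec_add_eq_zero_imp:
  fixes a c :: "real vec"
  assumes "a \<in> carrier_vec m" "c \<in> carrier_vec m" "a + c = 0\<^sub>v m"
  shows "a = - c"
proof (rule eq_vecI)
  fix i assume "i < dim_vec (- c)"
  then have "i < m" using assms(2) by simp
  moreover have "(a + c) $ i = 0\<^sub>v m $ i" using assms(3) by simp
  ultimately show "a $ i = (- c) $ i" using assms(1,2) by simp
qed (use assms in simp)

lemma mult_mat_vec_uminus:
  fixes A :: "real mat"
  assumes "A \<in> carrier_mat m q" "x \<in> carrier_vec q"
  shows "A *\<^sub>v (- x) = - (A *\<^sub>v x)"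
proof -
  have neg: "(- 1) \<cdot>\<^sub>v v = - v" for v :: "real vec" by (intro eq_vecI) auto
  show ?thesis using mult_mat_vec[OF assms, of "- 1"] by (simp only: neg)
qed

text \<open>The stacked vector of \<open>u\<close> and \<open>- w\<close> lies in the null space of
  \<open>[A, B]\<close>. Consequently every invariant set is contained in the range of
  \<open>ZA\<close>, and a refinement by \<open>ZA\<close> loses none of them.\<close>

lemma null_basis_solve:
  assumes nb: "null_basis A B ZA ZB" and "A \<in> carrier_mat m q" "B \<in> carrier_mat m q"
    and u: "u \<in> carrier_vec q" and w: "w \<in> carrier_vec q" and "A *\<^sub>v u = B *\<^sub>v w"
  shows "u \<in> col_range ZA"
proof -
  have "A *\<^sub>v u + B *\<^sub>v (- w) = B *\<^sub>v w + - (B *\<^sub>v w)"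
    using mult_mat_vec_uminus[OF assms(3) w] assms(6) by simp
  also have "\<dots> = 0\<^sub>v m"
    using assms(3) w by (intro uminus_r_inv_vec) simp
  finally have "A *\<^sub>v u + B *\<^sub>v (- w) = 0\<^sub>v m" .
  moreover have "\<forall>u \<in> carrier_vec q. \<forall>w \<in> carrier_vec q. A *\<^sub>v u + B *\<^sub>v w = 0\<^sub>v m \<longrightarrow>
      (\<exists>x \<in> carrier_vec (dim_col ZA). ZA *\<^sub>v x = u \<and> ZB *\<^sub>v x = w)"
    using nb assms(2) by (simp add: null_basis_def)
  moreover have "- w \<in> carrier_vec q" using w by simp
  ultimately have "\<exists>x \<in> carrier_vec (dim_col ZA). ZA *\<^sub>v x = u"
    using u by blast
  then show ?thesis
    by (auto simp: col_range_def)
qed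

text \<open>If \<open>ZA\<close> kills \<open>x\<close>, the null-space equation leaves only
  \<open>B\<close> applied to \<open>ZB x\<close>, so injectivity of \<open>B\<close> kills
  \<open>ZB x\<close> as well; independence of the stacked columns gives \<open>x = 0\<close>. Thus
  \<open>B * ZA\<close> is again injective and the loop invariant survives.\<close>

lemma null_basis_full_col_rank:
  assumes nb: "null_basis A B ZA ZB" and "A \<in> carrier_mat m q" "B \<in> carrier_mat m q"
    and "full_col_rank B"
  shows "full_col_rank ZA"
  unfolding full_col_rank_def
proof (intro ballI impI)
  define p where "p = dim_col ZA"
  have Z: "ZA \<in> carrier_mat q p" "ZB \<in> carrier_mat q p"
    using nb assms(2) by (auto simp: null_basis_def p_def)
  fix x assume "x \<in> carrier_vec (dim_col ZA)" "ZA *\<^sub>v x = 0\<^sub>v (dim_row ZA)"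
  then have x: "x \<in> carrier_vec p" "ZA *\<^sub>v x = 0\<^sub>v q" using Z by auto
  have ZBx: "ZB *\<^sub>v x \<in> carrier_vec q" using Z x by simp
  have "\<forall>x \<in> carrier_vec p. A *\<^sub>v (ZA *\<^sub>v x) + B *\<^sub>v (ZB *\<^sub>v x) = 0\<^sub>v m"
    using nb assms(2) by (simp add: null_basis_def p_def)
  then have "A *\<^sub>v (ZA *\<^sub>v x) + B *\<^sub>v (ZB *\<^sub>v x) = 0\<^sub>v m"
    using x(1) by blast
  moreover have "B *\<^sub>v (ZB *\<^sub>v x) \<in> carrier_vec m"
    using ZBx assms(3) by simp
  ultimately have "B *\<^sub>v (ZB *\<^sub>v x) = 0\<^sub>v m"
    using x(2) assms(2) by (simp add: mult_mat_zero_vec)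
  then have "ZB *\<^sub>v x = 0\<^sub>v q"
    using full_col_rankD[OF assms(4,3) ZBx] by simp
  moreover have "\<forall>x \<in> carrier_vec p. ZA *\<^sub>v x = 0\<^sub>v q \<and> ZB *\<^sub>v x = 0\<^sub>v q \<longrightarrow> x = 0\<^sub>v p"
    using nb assms(2) by (simp add: null_basis_def p_def)
  ultimately show "x = 0\<^sub>v (dim_col ZA)"
    using x by (simp add: p_def)
qed

text \<open>Induction on the run of the loop. Factoring out the accumulated \<open>C\<close> leaves
  a claim about the current \<open>A\<close> and \<open>B\<close> alone; the factor \<open>F\<close>
  of the next pass becomes \<open>ZA * F\<close> for the present one.\<close>

lemma ssd_iter_greatest:
  assumes "ssd_iter A B C out"
    and "A \<in> carrier_mat m q" "B \<in> carrier_mat m q" "C \<in> carrier_mat n q" "full_col_rank B"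
  shows "\<exists>F r. F \<in> carrier_mat q r \<and> full_col_rank F \<and> out = C * F \<and>
           maps_into A B (col_range F) \<and>
           (\<forall>S \<subseteq> carrier_vec q. maps_into A B S \<longrightarrow> S \<subseteq> col_range F)"
  using assms
proof (induction arbitrary: q rule: ssd_iter.induct)
  case (trivial A B ZA ZB C)
  \<comment> \<open>A matrix without columns still has the zero vector in its range, as the image of
    the empty vector.\<close>
  have range0: "col_range Z = {0\<^sub>v q}" if "Z \<in> carrier_mat q 0" for Z
    using that by (auto simp: col_range_def intro!: exI[of _ "0\<^sub>v 0"] eq_vecI simp: scalar_prod_def)
  have "ZA \<in> carrier_mat q 0" using trivial by (auto simp: null_basis_def)
  then have R: "col_range ZA = {0\<^sub>v q}" by (rule range0)
  have "S \<subseteq> {0\<^sub>v q}" if "S \<subseteq> carrier_vec q" "maps_into A B S" for S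
  proof
    fix u assume "u \<in> S"
    then obtain w where "w \<in> S" "A *\<^sub>v u = B *\<^sub>v w" using \<open>maps_into A B S\<close> by (auto simp: maps_into_def)
    then show "u \<in> {0\<^sub>v q}"
      using null_basis_solve[OF trivial(1) trivial.prems(1,2), of u w] that \<open>u \<in> S\<close> R by blast
  qed
  then show ?case
    using trivial.prems
    by (intro exI[of _ "0\<^sub>m q 0"] exI[of _ 0]) (auto simp: full_col_rank_zero_cols range0 maps_into_def)
next
  case (stop A B ZA ZB C)
  define p where "p = dim_col ZA"
  have Z: "ZA \<in> carrier_mat q p" "ZB \<in> carrier_mat q p"
    using stop(1) stop.prems(1) by (auto simp: null_basis_def p_def)
  \<comment> \<open>At the stopping test \<open>ZA\<close> is injective with at least as many
    columns as rows, hence onto: every \<open>u\<close> is the upper half of a null vector, and the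
    whole space is invariant. So \<open>F\<close> is the identity.\<close>
  have "full_col_rank ZA" using null_basis_full_col_rank stop by blast
  then have R: "col_range ZA = carrier_vec q"
    using full_col_rank_surj[OF _ Z(1)] stop(3) Z(1) by simp
  have "maps_into A B (carrier_vec q)"
    unfolding maps_into_def
  proof
    fix u :: "real vec" assume u: "u \<in> carrier_vec q"
    then obtain x where x: "x \<in> carrier_vec p" "u = ZA *\<^sub>v x"
      using R Z(1) by (auto simp: col_range_def)
    have Zx: "ZB *\<^sub>v x \<in> carrier_vec q" using Z x by simp
    have "A *\<^sub>v u + B *\<^sub>v (ZB *\<^sub>v x) = 0\<^sub>v m"
      using stop(1) x stop.prems(1) by (simp add: null_basis_def p_def)
    moreover have "A *\<^sub>v u \<in> carrier_vec m" "B *\<^sub>v (ZB *\<^sub>v x) \<in> carrier_vec m"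
      using stop.prems(1,2) u Zx by simp_all
    ultimately have "A *\<^sub>v u = - (B *\<^sub>v (ZB *\<^sub>v x))"
      by (simp add: vec_add_eq_zero_imp)
    then have "A *\<^sub>v u = B *\<^sub>v (- (ZB *\<^sub>v x))"
      using mult_mat_vec_uminus[OF stop.prems(2) Zx] by simp
    then show "\<exists>w \<in> carrier_vec q. A *\<^sub>v u = B *\<^sub>v w"
      using Zx uminus_carrier_vec by blast
  qed
  then show ?case
    using stop.prems
    by (intro exI[of _ "1\<^sub>m q"] exI[of _ q]) (auto simp: full_col_rank_one col_range_one)
next
  case (step A B ZA ZB C out)
  define p where "p = dim_col ZA"
  have Z: "ZA \<in> carrier_mat q p" using step(1) step.prems(1) by (auto simp: null_basis_def p_def)
  have rank: "full_col_rank ZA" using null_basis_full_col_rank step by blast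
  have "full_col_rank (B * ZA)"
    using full_col_rank_mult[OF step.prems(4) rank step.prems(2) Z] .
  note IH = step.IH[OF mult_carrier_mat[OF step.prems(1) Z] mult_carrier_mat[OF step.prems(2) Z]
      mult_carrier_mat[OF step.prems(3) Z] this]
  obtain F r where
    F: "F \<in> carrier_mat p r" "full_col_rank F" "out = C * ZA * F"
      "maps_into (A * ZA) (B * ZA) (col_range F)"
      "\<forall>S \<subseteq> carrier_vec p. maps_into (A * ZA) (B * ZA) S \<longrightarrow> S \<subseteq> col_range F"
    using IH by blast
  note FZ = maps_into_greatest_mult[OF step.prems(1,2) Z F(1,4,5)]
  have "S \<subseteq> col_range (ZA * F)" if S: "S \<subseteq> carrier_vec q" "maps_into A B S" for S
  proof (rule FZ(2))
    show "S \<subseteq> col_range ZA"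
    proof
      fix u assume "u \<in> S"
      then obtain w where "w \<in> S" "A *\<^sub>v u = B *\<^sub>v w" using S(2) by (auto simp: maps_into_def)
      then show "u \<in> col_range ZA"
        using null_basis_solve[OF step(1) step.prems(1,2), of u w] S(1) \<open>u \<in> S\<close> by blast
    qed
  qed (rule S(2))
  moreover have "out = C * (ZA * F)"
    using F(3) assoc_mult_mat[OF step.prems(3) Z F(1)] by simp
  ultimately show ?case
    using FZ(1) full_col_rank_mult[OF rank F(2) Z F(1)] mult_carrier_mat[OF Z F(1)] by blast
qed

text \<open>The form in which SSD is used below: an agent takes for \<open>D\<close> the basis of
  the intersection it has computed, the centralized run takes the identity.\<close>

lemma ssd_greatest:
  assumes "ssd (A * D) (B * D) E"
    and A: "A \<in> carrier_mat m n" and B: "B \<in> carrier_mat m n" and "dim_row D = n"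
    and rank: "full_col_rank B" "full_col_rank D"
  shows "dim_row E = dim_col D" "full_col_rank (D * E)"
    "col_range (D * E) \<subseteq> col_range D" "maps_into A B (col_range (D * E))"
    "\<And>S. S \<subseteq> col_range D \<Longrightarrow> maps_into A B S \<Longrightarrow> S \<subseteq> col_range (D * E)"
proof -
  define q where "q = dim_col D"
  have D: "D \<in> carrier_mat n q" using assms(4) unfolding q_def by (intro carrier_matI) simp_all
  have AD: "A * D \<in> carrier_mat m q" and BD: "B * D \<in> carrier_mat m q"
    using mult_carrier_mat[OF A D] mult_carrier_mat[OF B D] .
  have rankBD: "full_col_rank (B * D)"
    using full_col_rank_mult[OF rank B D] .
  have iter: "ssd_iter (A * D) (B * D) (1\<^sub>m q) E"
    using assms(1) by (simp add: ssd_def q_def)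
  obtain F r where F: "F \<in> carrier_mat q r" "full_col_rank F" "E = 1\<^sub>m q * F"
      "maps_into (A * D) (B * D) (col_range F)"
      "\<forall>S \<subseteq> carrier_vec q. maps_into (A * D) (B * D) S \<longrightarrow> S \<subseteq> col_range F"
    using ssd_iter_greatest[OF iter AD BD one_carrier_mat rankBD] by (elim exE conjE) (rule that)
  have EF: "E = F" using F(1,3) by simp
  show "dim_row E = dim_col D" using F(1) by (simp add: EF q_def)
  show "full_col_rank (D * E)" unfolding EF using full_col_rank_mult[OF rank(2) F(2) D F(1)] .
  show "col_range (D * E) \<subseteq> col_range D"
    unfolding EF col_range_mult[OF D F(1)]
    using col_range_carrier[OF F(1)] unfolding q_def by (intro image_subsetI col_rangeI) blast
  note FD = maps_into_greatest_mult[OF A B D F(1,4,5)]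
  show "maps_into A B (col_range (D * E))" unfolding EF by (rule FD(1))
  show "\<And>S. S \<subseteq> col_range D \<Longrightarrow> maps_into A B S \<Longrightarrow> S \<subseteq> col_range (D * E)"
    unfolding EF by (rule FD(2))
qed

section \<open>Comparison of data through rows, propagation along digraphs, stabilization\<close>

lemma mult_mat_vec_eq_iff_rows:
  assumes "A \<in> carrier_mat m q" "B \<in> carrier_mat m q"
  shows "A *\<^sub>v u = B *\<^sub>v w \<longleftrightarrow> (\<forall>r < m. row A r \<bullet> u = row B r \<bullet> w)"
  using assms by (auto simp: vec_eq_iff)

text \<open>The equation is a conjunction over row pairs, so it passes to any data whose row pairs
  occur among the given ones. Pairs, not single rows, keep the two snapshots of an observation
  together.\<close>

lemma mult_mat_vec_eq_mono:
  assumes "A \<in> carrier_mat m q" "B \<in> carrier_mat m q"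
    and "A' \<in> carrier_mat m' q" "B' \<in> carrier_mat m' q"
    and "{(row A' r, row B' r) | r. r < m'} \<subseteq> {(row A r, row B r) | r. r < m}"
    and "A *\<^sub>v u = B *\<^sub>v w"
  shows "A' *\<^sub>v u = B' *\<^sub>v w"
  unfolding mult_mat_vec_eq_iff_rows[OF assms(3,4)]
proof (intro allI impI)
  fix r assume "r < m'"
  then have "(row A' r, row B' r) \<in> {(row A r, row B r) | r. r < m}" using assms(5) by blast
  then obtain s where "s < m" "row A' r = row A s" "row B' r = row B s" by blast
  then show "row A' r \<bullet> u = row B' r \<bullet> w"
    using assms(6) unfolding mult_mat_vec_eq_iff_rows[OF assms(1,2)] by simp
qed

text \<open>Additional rows only add equations to the kernel. This transfers the rank of the
  signature matrix to the data of each agent.\<close>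

lemma full_col_rank_mono:
  assumes "full_col_rank A'" "A \<in> carrier_mat m q" "A' \<in> carrier_mat m' q"
    and "set (rows A') \<subseteq> set (rows A)"
  shows "full_col_rank A"
  unfolding full_col_rank_def
proof (intro ballI impI)
  fix x assume "x \<in> carrier_vec (dim_col A)" "A *\<^sub>v x = 0\<^sub>v (dim_row A)"
  then have x: "x \<in> carrier_vec q" "A *\<^sub>v x = 0\<^sub>v m" using assms by auto
  have "row A' r \<bullet> x = 0" if "r < m'" for r
  proof -
    have "row A' r \<in> set (rows A)" using that assms by (auto simp: rows_def)
    then obtain s where "s < m" "row A' r = row A s" using assms by (auto simp: rows_def)
    then show ?thesis using x(2) assms(2) by (metis carrier_matD(1) index_mult_mat_vec index_zero_vec(1))
  qed
  then have "A' *\<^sub>v x = 0\<^sub>v m'" using assms by (intro eq_vecI) auto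
  then show "x = 0\<^sub>v (dim_col A)" using full_col_rankD[OF assms(1,3) x(1)] assms(2) by simp
qed

text \<open>An edge of the composition is a chain of edges of successive digraphs, along which the
  inclusions compose. The bound \<open>a\<close> is there because the inclusions hold only once the
  matrices have settled.\<close>

lemma comp_seq_antimono:
  assumes "\<And>k i j. k \<ge> a \<Longrightarrow> (j, i) \<in> G k \<Longrightarrow> R i \<subseteq> R j" and "(j, i) \<in> comp_seq M G a n"
  shows "R i \<subseteq> R j"
  using assms(2)
proof (induction n arbitrary: i)
  case 0
  then show ?case by auto
next
  case (Suc n)
  then obtain h where "(j, h) \<in> comp_seq M G a n" "(h, i) \<in> G (a + n)"
    by (auto simp: dg_comp_def)
  then have "R h \<subseteq> R j" "R i \<subseteq> R h" using Suc.IH assms(1)[of "a + n" h i] by simp_all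
  then show ?case by (rule order_trans[rotated])
qed

lemma antimono_on_trancl:
  assumes "\<And>i j. (j, i) \<in> E \<Longrightarrow> R i \<subseteq> R j" and "(j, i) \<in> E\<^sup>+"
  shows "R i \<subseteq> R j"
  using assms(2)
proof induction
  case (step h i)
  then show ?case using assms(1)[of h i] by blast
qed (rule assms(1))

lemma nonincreasing_eventually_const:
  fixes f :: "nat \<Rightarrow> nat"
  assumes "\<And>k. f (Suc k) \<le> f k"
  shows "\<exists>l. \<forall>k \<ge> l. f k = f l"
proof -
  obtain l where l: "\<And>k. f l \<le> f k"
    using ex_has_least_nat[of "\<lambda>_. True" 0 f] by auto
  have "f k \<le> f l" if "k \<ge> l" for k
    using lift_Suc_antimono_le[of f l k] assms that by simp
  then show ?thesis using l by (meson le_antisym)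
qed

section \<open>Convergence of P-SSD\<close>

theorem theorem6p1:
  fixes M Nd N Ns :: nat
    and DX DY DXs DYs :: "real mat"
    and Ni :: "nat \<Rightarrow> nat"
    and DXi DYi :: "nat \<Rightarrow> real mat"
    and G :: "nat \<Rightarrow> (nat \<times> nat) set"
    and C :: "nat \<Rightarrow> nat \<Rightarrow> real mat"
    and CSSD :: "real mat"
  assumes DX: "DX \<in> carrier_mat N Nd" and DY: "DY \<in> carrier_mat N Nd"
    and rankX: "full_col_rank DX" and rankY: "full_col_rank DY"
    and local_dims: "\<forall>i \<in> {1..M}. DXi i \<in> carrier_mat (Ni i) Nd \<and> DYi i \<in> carrier_mat (Ni i) Nd"
    and local_union:
      "{(row (DXi i) r, row (DYi i) r) | i r. i \<in> {1..M} \<and> r < Ni i}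
         = {(row DX r, row DY r) | r. r < N}"
    and sig_dims: "DXs \<in> carrier_mat Ns Nd" "DYs \<in> carrier_mat Ns Nd"
    and sig_rank: "full_col_rank DXs" "full_col_rank DYs"
    and sig_rows: "\<forall>i \<in> {1..M}.
        {(row DXs r, row DYs r) | r. r < Ns} \<subseteq> {(row (DXi i) r, row (DYi i) r) | r. r < Ni i}"
    and graph: "\<forall>k. G k \<subseteq> {1..M} \<times> {1..M}"
    and rjsc: "rep_jointly_strongly_connected M G"
    and run: "pssd_run M Nd G DXi DYi C"
    and cssd: "ssd DX DY CSSD"
  shows "\<exists>l. \<forall>k \<ge> l. \<forall>i \<in> {1..M}.
            C k i = C l i \<and> col_range (C l i) = col_range CSSD"
proof -
  have DXi: "DXi i \<in> carrier_mat (Ni i) Nd" and DYi: "DYi i \<in> carrier_mat (Ni i) Nd"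
    if "i \<in> {1..M}" for i
    using local_dims that by auto
  have rankYi: "full_col_rank (DYi i)" if i: "i \<in> {1..M}" for i
  proof (rule full_col_rank_mono[OF sig_rank(2) DYi[OF i] sig_dims(2)])
    show "set (rows DYs) \<subseteq> set (rows (DYi i))"
    proof
      fix v assume "v \<in> set (rows DYs)"
      then obtain r where "r < Ns" "v = row DYs r" using sig_dims by (auto simp: rows_def)
      then have "(row DXs r, v) \<in> {(row (DXi i) r, row (DYi i) r) | r. r < Ni i}"
        using sig_rows i by blast
      then show "v \<in> set (rows (DYi i))" using DYi[OF i] by (auto simp: rows_def)
    qed
  qed

  \<comment> \<open>The space whose basis agent \<open>i\<close> computes at iteration
    \<open>k\<close>, from the matrices of iteration \<open>k - 1\<close>.\<close>
  define W where "W k i = (\<Inter>j \<in> insert i (in_nbrs M (G k) i). col_range (C (k - 1) j))" for k i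
  have good: "dim_row (C k i) = Nd \<and> full_col_rank (C k i)"
    if "i \<in> {1..M}" for k i
    using that
  proof (induction k arbitrary: i)
    case 0
    then show ?case using run by (auto simp: pssd_run_def full_col_rank_one)
  next
    case (Suc k)
    obtain D E where DE: "is_basis_mat Nd (W (Suc k) i) D" "ssd (DXi i * D) (DYi i * D) E"
      "C (Suc k) i = (if dim_col (D * E) < dim_col (C k i) then D * E else C k i)"
      using run Suc.prems unfolding pssd_run_def W_def
      by (metis diff_Suc_1 le_add1 plus_1_eq_Suc)
    have D: "dim_row D = Nd" "full_col_rank D"
      using DE(1) by (auto simp: is_basis_mat_def)
    note g = ssd_greatest[OF DE(2) DXi[OF Suc.prems] DYi[OF Suc.prems] D(1) rankYi[OF Suc.prems] D(2)]
    show ?case using DE(3) D(1) g(2) Suc by auto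
  qed
  \<comment> \<open>Whichever branch the update takes, the new range is the greatest set inside
    \<open>W\<close> that is invariant for the agent's own data.\<close>
  have run_step: "dim_col (C (Suc k) i) \<le> dim_col (C k i) \<and>
      (dim_col (C (Suc k) i) = dim_col (C k i) \<longrightarrow> C (Suc k) i = C k i) \<and>
      col_range (C (Suc k) i) \<subseteq> W (Suc k) i \<and>
      maps_into (DXi i) (DYi i) (col_range (C (Suc k) i)) \<and>
      (\<forall>S \<subseteq> W (Suc k) i. maps_into (DXi i) (DYi i) S \<longrightarrow> S \<subseteq> col_range (C (Suc k) i))"
    if i: "i \<in> {1..M}" for k i
  proof -
    obtain D E where DE: "is_basis_mat Nd (W (Suc k) i) D" "ssd (DXi i * D) (DYi i * D) E"
      "C (Suc k) i = (if dim_col (D * E) < dim_col (C k i) then D * E else C k i)"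
      using run i unfolding pssd_run_def W_def
      by (metis diff_Suc_1 le_add1 plus_1_eq_Suc)
    have D: "dim_row D = Nd" "full_col_rank D" "col_range D = W (Suc k) i"
      using DE(1) by (auto simp: is_basis_mat_def)
    note g = ssd_greatest[OF DE(2) DXi[OF i] DYi[OF i] D(1) rankYi[OF i] D(2)]
    have "W (Suc k) i \<subseteq> col_range (C k i)" by (auto simp: W_def)
    then have sub: "col_range (D * E) \<subseteq> col_range (C k i)" using g(3) D(3) by auto
    \<comment> \<open>In the branch that keeps the old matrix, \<open>D * E\<close> has at least as
      many independent columns and a range inside the old one, so the ranges coincide although the
      matrices may differ.\<close>
    have "col_range (C (Suc k) i) = col_range (D * E)"
      using DE(3) col_range_eq_of_dim[OF g(2) sub] good[OF i, of k] D(1) by auto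
    then show ?thesis using DE(3) g(3-5) D(3) by auto
  qed

  have "\<exists>l. \<forall>k \<ge> l. dim_col (C k i) = dim_col (C l i)" if "i \<in> {1..M}" for i
    using nonincreasing_eventually_const[of "\<lambda>k. dim_col (C k i)"] run_step[OF that] by blast
  then obtain l where l: "\<And>i k. i \<in> {1..M} \<Longrightarrow> k \<ge> l i \<Longrightarrow> dim_col (C k i) = dim_col (C (l i) i)"
    by metis
  \<comment> \<open>Inserting \<open>0\<close> keeps the maximum well defined when there are no
    agents.\<close>
  define L where "L = Max (insert 0 (l ` {1..M}))"
  have L: "l i \<le> L" if "i \<in> {1..M}" for i using that by (auto simp: L_def)
  \<comment> \<open>An unchanged column count means that the old matrix was kept, so the matrices
    themselves become constant, not only their ranges.\<close>
  have const: "C k i = C L i" if i: "i \<in> {1..M}" and "k \<ge> L" for k i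
    using \<open>k \<ge> L\<close>
  proof (induction k rule: dec_induct)
    case (step k)
    have "dim_col (C (Suc k) i) = dim_col (C k i)"
      using l[OF i, of k] l[OF i, of "Suc k"] L[OF i] step by simp
    then show ?case using run_step[OF i, of k] step.IH by simp
  qed simp

  define R where "R i = col_range (C L i)" for i
  \<comment> \<open>The strict bound matters: iteration \<open>k\<close> reads the matrices of
    iteration \<open>k - 1\<close>, which must already be final.\<close>
  have edge: "R i \<subseteq> R j" if "k > L" "(j, i) \<in> G k" for k i j
  proof -
    have ij: "i \<in> {1..M}" "j \<in> {1..M}" using graph that(2) by blast+
    obtain k' where k': "k = Suc k'" "k' \<ge> L" using \<open>k > L\<close> by (cases k) auto
    have "R i \<subseteq> W k i" using run_step[OF ij(1), of k'] const[OF ij(1), of k] k' by (simp add: R_def)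
    also have "\<dots> \<subseteq> col_range (C k' j)" using ij that(2) by (auto simp: W_def in_nbrs_def k')
    also have "\<dots> = R j" using const[OF ij(2) k'(2)] by (simp only: R_def)
    finally show ?thesis .
  qed
  obtain p \<tau> where p: "p \<ge> 1" "\<And>k. strongly_connected M (comp_seq M G (\<tau> + k * p) p)"
    using rjsc by (auto simp: rep_jointly_strongly_connected_def jointly_strongly_connected_def)
  \<comment> \<open>The window with index \<open>Suc L\<close> starts after \<open>L\<close> because
    each window has length at least one.\<close>
  define a where "a = \<tau> + Suc L * p"
  have "Suc L * 1 \<le> Suc L * p" using p(1) by (rule mult_le_mono2)
  then have a: "a > L" by (simp add: a_def)
  have "R i \<subseteq> R j" if "(j, i) \<in> comp_seq M G a p" for i j
    using comp_seq_antimono[of a G R j i M p] edge a that by (meson less_le_trans)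
  then have "R i \<subseteq> R j" if "(j, i) \<in> (comp_seq M G a p)\<^sup>+" for i j
    using antimono_on_trancl that by metis
  then have all: "R i = R j" if "i \<in> {1..M}" "j \<in> {1..M}" for i j
    using that p(2)[of "Suc L"] unfolding strongly_connected_def a_def[symmetric]
    by (metis subset_antisym)

  \<comment> \<open>Multiplication by the identity puts the centralized run into the restricted
    form, with the whole space as the range of \<open>D\<close>.\<close>
  have "ssd (DX * 1\<^sub>m Nd) (DY * 1\<^sub>m Nd) CSSD" using cssd DX DY by simp
  note g = ssd_greatest[OF this DX DY index_one_mat(2) rankY full_col_rank_one]
  have CSSD: "1\<^sub>m Nd * CSSD = CSSD" using g(1) by (intro left_mult_one_mat) auto
  note g = g[unfolded CSSD col_range_one]

  have rowsi: "{(row (DXi i) r, row (DYi i) r) | r. r < Ni i} \<subseteq> {(row DX r, row DY r) | r. r < N}"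
    if "i \<in> {1..M}" for i
    using that local_union by blast
  \<comment> \<open>An invariant set for all data is invariant for each agent's rows. By induction
    it lies in every received range, and maximality keeps it in the new one.\<close>
  have lower: "col_range CSSD \<subseteq> col_range (C k i)" if "i \<in> {1..M}" for k i
    using that
  proof (induction k arbitrary: i)
    case 0
    then show ?case using run g(3) by (auto simp: pssd_run_def col_range_one)
  next
    case (Suc k)
    note i = Suc.prems
    have "maps_into (DXi i) (DYi i) (col_range CSSD)"
      using g(4) mult_mat_vec_eq_mono[OF DX DY DXi[OF i] DYi[OF i] rowsi[OF i]]
      unfolding maps_into_def by blast
    moreover have "col_range CSSD \<subseteq> W (Suc k) i"
      using Suc.IH i by (auto simp: W_def in_nbrs_def)
    ultimately show ?case using run_step[OF i] by blast
  qed
  have upper: "R i \<subseteq> col_range CSSD" if i: "i \<in> {1..M}" for i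
  proof (rule g(5))
    have "C L i \<in> carrier_mat Nd (dim_col (C L i))"
      using good[OF i, of L] by (intro carrier_matI) simp_all
    then have Rsub: "R i \<subseteq> carrier_vec Nd"
      unfolding R_def by (rule col_range_carrier)
    then show "R i \<subseteq> carrier_vec Nd" .
    \<comment> \<open>The common range is also the final range of agent \<open>j\<close>, hence
      invariant for the data of \<open>j\<close>. \<open>Suc L\<close> appears because
      \<open>run_step\<close> describes matrices that result from an iteration.\<close>
    have inv: "maps_into (DXi j) (DYi j) (R i)" if j: "j \<in> {1..M}" for j
    proof -
      have "R i = col_range (C (Suc L) j)"
        using all[OF i j] unfolding const[OF j le_SucI[OF order_refl]] R_def .
      then show ?thesis
        using run_step[OF j, of L] by simp
    qed
    show "maps_into DX DY (R i)"
      unfolding maps_into_def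
    proof
      fix u assume u: "u \<in> R i"
      obtain w where w: "\<And>j. j \<in> {1..M} \<Longrightarrow> w j \<in> R i \<and> DXi j *\<^sub>v u = DYi j *\<^sub>v w j"
      proof -
        have "\<forall>j \<in> {1..M}. \<exists>w. w \<in> R i \<and> DXi j *\<^sub>v u = DYi j *\<^sub>v w"
          using inv u unfolding maps_into_def by blast
        from bchoice[OF this] show ?thesis using that by blast
      qed
      \<comment> \<open>The signature data, common to all agents, force the agents' preimages to agree.\<close>
      have sig: "DXs *\<^sub>v u = DYs *\<^sub>v w j" if j: "j \<in> {1..M}" for j
        using mult_mat_vec_eq_mono[OF DXi[OF j] DYi[OF j] sig_dims] sig_rows w j by blast
      have eq: "w j = w i" if j: "j \<in> {1..M}" for j
        using full_col_rank_inj[OF sig_rank(2) sig_dims(2), of "w j" "w i"] sig[OF i] sig[OF j]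
          w[OF i] w[OF j] Rsub by (metis subsetD)
      \<comment> \<open>Each centralized row pair belongs to some agent \<open>j\<close>, whose
        preimage \<open>w j\<close> is the common vector \<open>w i\<close>.\<close>
      have "row DX r \<bullet> u = row DY r \<bullet> w i" if "r < N" for r
      proof -
        have "(row DX r, row DY r) \<in> {(row (DXi i) r, row (DYi i) r) | i r. i \<in> {1..M} \<and> r < Ni i}"
          unfolding local_union using that by blast
        then obtain j s where js: "j \<in> {1..M}" "s < Ni j" "row DX r = row (DXi j) s" "row DY r = row (DYi j) s"
          by blast
        then show ?thesis
          using w[OF js(1)] unfolding eq[OF js(1)] js(3,4)
            mult_mat_vec_eq_iff_rows[OF DXi[OF js(1)] DYi[OF js(1)]] by blast
      qed
      then have "DX *\<^sub>v u = DY *\<^sub>v w i" unfolding mult_mat_vec_eq_iff_rows[OF DX DY] by blast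
      then show "\<exists>v \<in> R i. DX *\<^sub>v u = DY *\<^sub>v v" using w[OF i] by blast
    qed
  qed
  show ?thesis
    using const lower upper unfolding R_def by blast
qed

end
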